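(* Let $p$ be a prime and let $n$ be a positive integer. Then $$\frac{1}{n^3}\left(\sum_{k=0}^{pn-1}(3k+2)(-1)^kf_k-p^2\sum_{k=0}^{n-1}(3k+2)(-1)^kf_k\right)\equiv 0\pmod{p^{3}}.$$
   Context: For each integer $n\ge 0$, the Franel number $f_n$ is $$f_n=\sum_{k=0}^{n}\binom{n}{k}^3.$$ For a rational number $x$ and an integer $N\ge 0$, the congruence $x\equiv 0\pmod{p^N}$ means that $x\in p^N\mathbb{Z}_{(p)}$, where $\mathbb{Z}_{(p)}$ is the ring of rational numbers whose denominator in lowest terms is not divisible by $p$. (The left-hand side in the claim is a rational number that need not be an integer.) *)

theory Defs
  imports Complex_Main "HOL-Computational_Algebra.Primes"
begin

definition franel :: "nat \<Rightarrow> nat" where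
  "franel n = (\<Sum>k=0..n. (n choose k) ^ 3)"

(* quotient_of yields the fraction in lowest terms, with positive denominator as
   second component. *)
definition Z_loc :: "nat \<Rightarrow> rat set" where
  "Z_loc p = {x. \<not> int p dvd snd (quotient_of x)}"

definition rat_cong_0 :: "rat \<Rightarrow> nat \<Rightarrow> nat \<Rightarrow> bool" where
  "rat_cong_0 x p N \<longleftrightarrow> x \<in> (\<lambda>y. of_nat p ^ N * y) ` Z_loc p"

end

theory Submission
  imports Defs "HOL-Number_Theory.Cong"
begin

text \<open>
  Write \<open>a\<^sub>n = (-1)\<^sup>n f\<^sub>n\<close> and let \<open>S(n)\<close> be the sum of \<open>(3k + 2) a\<^sub>k\<close> over \<open>k < n\<close>.
  In Franel's recurrence
  \<open>(n + 2)\<^sup>2 f\<^sub>n\<^sub>+\<^sub>2 = (7n\<^sup>2 + 21n + 16) f\<^sub>n\<^sub>+\<^sub>1 + 8(n + 1)\<^sup>2 f\<^sub>n\<close>, the signs of the \<open>a\<^sub>k\<close> turn the sum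
  of the three coefficients that a given \<open>a\<^sub>k\<close> receives into \<open>-3(3k + 2)\<close>.
  Summing the recurrence therefore telescopes to
  \<open>3 S(n) = n\<^sup>2 b\<^sub>n\<close> with \<open>b\<^sub>n = a\<^sub>n + 8 a\<^sub>n\<^sub>-\<^sub>1\<close> (lemma \<open>franel_weighted_eq\<close>), and
  \<open>3 (S(pn) - p\<^sup>2 S(n)) = p\<^sup>2 n\<^sup>2 (b\<^sub>p\<^sub>n - b\<^sub>n)\<close>.

  If \<open>p\<^sup>e\<close> exactly divides \<open>n\<close>, the factor \<open>p\<^sup>2 n\<^sup>2\<close> supplies \<open>2e + 2\<close> powers of \<open>p\<close> of the \<open>3e + 3\<close>
  needed. What is left is a Gauss congruence: \<open>b\<^sub>p\<^sub>n\<close> and \<open>b\<^sub>n\<close> agree modulo \<open>p\<^sup>e\<^sup>+\<^sup>1\<close>, and even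
  modulo \<open>3 p\<^sup>e\<^sup>+\<^sup>1\<close> when \<open>p = 3\<close>, to make up for the factor 3 on the left. Both cases are covered
  by the modulus \<open>gcd 3 p * p\<^sup>e\<^sup>+\<^sup>1\<close> in lemma \<open>franel_gauss_cong\<close>.

  The congruence comes from that of the binomial coefficients
  \<open>pn - 1 choose k\<close> and \<open>\<plusminus> (n - 1 choose k div p)\<close> modulo \<open>p\<^sup>e\<^sup>+\<^sup>1\<close> (lemma \<open>binomial_pred_cong\<close>). Franel
  numbers are sums of cubes, and cubing gains the extra factor 3 when \<open>p = 3\<close> (lemma \<open>cong_cube\<close>).
  Grouping the summation index by its quotient on division by \<open>p\<close> then gives \<open>f\<^sub>p\<^sub>n \<equiv> f\<^sub>n\<close> and
  \<open>f\<^sub>p\<^sub>n\<^sub>-\<^sub>1 \<equiv> f\<^sub>n\<^sub>-\<^sub>1\<close> for odd \<open>p\<close>. For \<open>p = 2\<close> the signs interfere: \<open>f\<^sub>2\<^sub>n\<^sub>-\<^sub>1\<close> is then congruent to 0,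
  and the coefficient 8 makes the terms \<open>8 a\<^sub>2\<^sub>n\<^sub>-\<^sub>1\<close> and \<open>8 a\<^sub>n\<^sub>-\<^sub>1\<close> vanish separately.
\<close>

section \<open>The Franel recurrence and a closed form for the sums\<close>

definition alt_franel :: "nat \<Rightarrow> int" where
  "alt_franel n = (- 1) ^ n * int (franel n)"

lemma absorb_left:
  "(int m - int k) * int (m choose k) = int m * int ((m - 1) choose k)"
proof (cases "k \<le> m")
  case True
  have "int ((m - k) * (m choose k)) = int (m * ((m - 1) choose k))"
    using binomial_absorb_comp[of m k] by simp
  then show ?thesis
    using True by (simp add: of_nat_diff)
next
  case False
  then show ?thesis
    by (simp add: binomial_eq_0)
qed

lemma absorb_right:
  "int (Suc k) * int (m choose Suc k) = (int m - int k) * int (m choose k)"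
proof -
  have "Suc k * (m choose Suc k) = (m choose k) * (m - k)"
    by (metis binomial_absorb_comp binomial_absorption mult.commute)
  then have "int (Suc k) * int (m choose Suc k) = int (m choose k) * int (m - k)"
    by (metis of_nat_mult)
  then show ?thesis
    by (cases "k \<le> m") (auto simp: of_nat_diff binomial_eq_0)
qed

text \<open>
  The polynomial factor of a Wilf-Zeilberger certificate for Franel's recurrence, found by
  comparing coefficients of powers of \<open>k\<close> in the identity of lemma \<open>franel_certificate\<close>.
\<close>

definition certificate :: "int \<Rightarrow> int \<Rightarrow> int" where
  "certificate n k = 4 * k ^ 3 - 6 * (3 * n + 5) * k ^ 2
     + 3 * (n + 2) * (9 * n + 13) * k - 2 * (n + 2) ^ 2 * (7 * n + 9)"

text \<open>
  The summand \<open>(n choose k)\<^sup>3\<close>, inserted into Franel's recurrence, is a difference in \<open>k\<close>.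
  Expressing all binomial coefficients as rational multiples of \<open>n + 2 choose k\<close> turns this into a
  polynomial identity; the factor \<open>(n + 1) (n + 2)\<^sup>3\<close> clears the denominators, so that the
  identity holds in the integers for every \<open>k\<close>, including the values \<open>k > n\<close> where
  \<open>n choose k\<close> is zero.
\<close>

lemma franel_certificate:
  fixes n k :: nat
  shows "(int n + 1) * (int n + 2) ^ 3 *
      ((int n + 2) ^ 2 * int (Suc (Suc n) choose k) ^ 3
       - (7 * int n ^ 2 + 21 * int n + 16) * int (Suc n choose k) ^ 3
       - 8 * (int n + 1) ^ 2 * int (n choose k) ^ 3)
    = certificate (int n) (int (Suc k)) * (int (Suc k) * int (Suc (Suc n) choose Suc k)) ^ 3
      - certificate (int n) (int k) * (int k * int (Suc (Suc n) choose k)) ^ 3"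
proof -
  define N K A B C where "N = int n" and "K = int k" and "A = int (n choose k)"
    and "B = int (Suc n choose k)" and "C = int (Suc (Suc n) choose k)"
  have h1: "(N + 2) * B = (N + 2 - K) * C"
    using absorb_left[of "Suc (Suc n)" k] by (simp add: N_def K_def B_def C_def algebra_simps)
  have h0: "(N + 1) * A = (N + 1 - K) * B"
    using absorb_left[of "Suc n" k] by (simp add: N_def K_def A_def B_def algebra_simps)
  have h2: "(N + 1) * (N + 2) * A = (N + 1 - K) * (N + 2 - K) * C"
    using h0 h1 by algebra
  have h3: "int (Suc k) * int (Suc (Suc n) choose Suc k) = (N + 2 - K) * C"
    unfolding absorb_right by (simp add: N_def K_def C_def)
  have "(N + 1) * (N + 2) ^ 3 * ((N + 2) ^ 2 * C ^ 3
        - (7 * N ^ 2 + 21 * N + 16) * B ^ 3 - 8 * (N + 1) ^ 2 * A ^ 3)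
      = (N + 1) * (N + 2) ^ 5 * C ^ 3
        - (N + 1) * (7 * N ^ 2 + 21 * N + 16) * ((N + 2) * B) ^ 3
        - 8 * ((N + 1) * (N + 2) * A) ^ 3"
    by algebra
  also have "\<dots> = certificate N (K + 1) * ((N + 2 - K) * C) ^ 3 - certificate N K * (K * C) ^ 3"
    unfolding h1 h2 certificate_def by algebra
  finally show ?thesis
    unfolding h3 by (simp add: N_def K_def A_def B_def C_def add.commute)
qed

lemma franel_sum:
  assumes "n \<le> m"
  shows "int (franel n) = (\<Sum>k\<le>m. int (n choose k) ^ 3)"
proof -
  have "(\<Sum>k\<le>m. int (n choose k) ^ 3) = (\<Sum>k\<le>n. int (n choose k) ^ 3)"
    using assms by (intro sum.mono_neutral_right) (auto simp: binomial_eq_0)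
  then show ?thesis
    by (simp add: franel_def atMost_atLeast0)
qed

lemma franel_recurrence:
  "(int n + 2) ^ 2 * int (franel (Suc (Suc n)))
     = (7 * int n ^ 2 + 21 * int n + 16) * int (franel (Suc n))
       + 8 * (int n + 1) ^ 2 * int (franel n)"
proof -
  define m where "m = Suc (Suc n)"
  define G where
    "G k = certificate (int n) (int k) * (int k * int (m choose k)) ^ 3" for k
  define c where "c = (int n + 1) * (int n + 2) ^ 3"
  have "c * ((int n + 2) ^ 2 * int (franel (Suc (Suc n)))
       - (7 * int n ^ 2 + 21 * int n + 16) * int (franel (Suc n))
       - 8 * (int n + 1) ^ 2 * int (franel n))
    = (\<Sum>k\<le>m. c * ((int n + 2) ^ 2 * int (Suc (Suc n) choose k) ^ 3
       - (7 * int n ^ 2 + 21 * int n + 16) * int (Suc n choose k) ^ 3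
       - 8 * (int n + 1) ^ 2 * int (n choose k) ^ 3))"
    using franel_sum[of n m] franel_sum[of "Suc n" m] franel_sum[of "Suc (Suc n)" m]
    by (simp add: m_def sum_distrib_left sum_subtractf right_diff_distrib del: sum.atMost_Suc)
  also have "\<dots> = (\<Sum>k\<le>m. G (Suc k) - G k)"
    unfolding c_def franel_certificate G_def m_def ..
  also have "\<dots> = G (Suc m) - G 0"
    by (simp add: atMost_atLeast0 sum_Suc_diff)
  also have "\<dots> = 0"
    by (simp add: G_def)
  finally show ?thesis
    by (simp add: c_def)
qed

text \<open>
  The induction step is the recurrence: the new term is
  \<open>3(3n + 5) a\<^sub>n\<^sub>+\<^sub>1 = (8(n + 2)\<^sup>2 - (n + 1)\<^sup>2 - (7n\<^sup>2 + 21n + 16)) a\<^sub>n\<^sub>+\<^sub>1\<close>.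
\<close>

lemma franel_weighted_sum:
  "3 * (\<Sum>k\<le>n. (3 * int k + 2) * alt_franel k)
     = (int n + 1) ^ 2 * (alt_franel (Suc n) + 8 * alt_franel n)"
proof (induction n)
  case 0
  show ?case
    by (simp add: alt_franel_def franel_def)
next
  case (Suc n)
  have rec: "(int n + 2) ^ 2 * alt_franel (Suc (Suc n))
     = - (7 * int n ^ 2 + 21 * int n + 16) * alt_franel (Suc n)
       + 8 * (int n + 1) ^ 2 * alt_franel n"
    using arg_cong[OF franel_recurrence[of n], of "(*) ((- 1) ^ n)"]
    by (simp add: alt_franel_def algebra_simps)
  have "3 * (\<Sum>k\<le>Suc n. (3 * int k + 2) * alt_franel k)
      = (int n + 1) ^ 2 * (alt_franel (Suc n) + 8 * alt_franel n)
        + 3 * (3 * (int n + 1) + 2) * alt_franel (Suc n)"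
    using Suc.IH by (simp add: algebra_simps)
  also have "\<dots> = (int n + 2) ^ 2 * (alt_franel (Suc (Suc n)) + 8 * alt_franel (Suc n))"
    using rec by algebra
  finally show ?case
    by (simp add: algebra_simps)
qed

section \<open>Binomial coefficients modulo prime powers\<close>

text \<open>
  In \<open>pn - 1 choose k\<close>, the product of \<open>(pn - i) / i\<close> over \<open>i = 1, \<dots>, k\<close>, the factors with
  \<open>i = p i'\<close> are \<open>(n - i') / i'\<close> and multiply to \<open>n - 1 choose k div p\<close>. The others are congruent
  to \<open>-1\<close>; \<open>P\<close> and \<open>Q\<close> are their numerator and denominator. Keeping them apart avoids fractions
  modulo \<open>p\<^sup>a\<close>. For \<open>k \<ge> pn\<close> both binomial coefficients vanish, so \<open>k\<close> is unrestricted.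
\<close>

lemma binomial_pred_factor:
  fixes p n a k :: nat
  assumes p: "prime p" and n: "n > 0" and a: "p ^ a dvd p * n"
  shows "\<exists>P Q. coprime Q (int p) \<and> [P = (- 1) ^ (k - k div p) * Q] (mod int p ^ a) \<and>
      int ((p * n - 1) choose k) * Q = int ((n - 1) choose (k div p)) * P"
proof (induction k)
  case 0
  show ?case
    by (rule exI[of _ 1], rule exI[of _ 1]) simp
next
  case (Suc k)
  then obtain P Q where Q: "coprime Q (int p)"
    and P: "[P = (- 1) ^ (k - k div p) * Q] (mod int p ^ a)"
    and eq: "int ((p * n - 1) choose k) * Q = int ((n - 1) choose (k div p)) * P"
    by blast
  have p0: "p > 0"
    using p prime_gt_0_nat by blast
  have step: "int (Suc k) * int ((m - 1) choose Suc k)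
      = (int m - int (Suc k)) * int ((m - 1) choose k)" if "m > 0" for m k
    using absorb_right[of k "m - 1"] that by (simp add: of_nat_diff algebra_simps)
  have stepk: "int (Suc k) * int ((p * n - 1) choose Suc k)
      = (int p * int n - int (Suc k)) * int ((p * n - 1) choose k)"
    using step[of "p * n" k] p0 n by simp
  show ?case
  proof (cases "p dvd Suc k")
    case False
    then have dv: "Suc k div p = k div p"
      by (simp add: div_Suc dvd_eq_mod_eq_0)
    have "[int p * int n - int (Suc k) = 0 - int (Suc k)] (mod int p ^ a)"
      using a by (intro cong_diff cong_refl)
        (metis cong_0_iff of_nat_dvd_iff of_nat_mult of_nat_power)
    then have "[(int p * int n - int (Suc k)) * P
        = (0 - int (Suc k)) * ((- 1) ^ (k - k div p) * Q)] (mod int p ^ a)"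
      using P by (rule cong_mult)
    also have "(0 - int (Suc k)) * ((- 1) ^ (k - k div p) * Q)
        = (- 1) ^ (Suc k - Suc k div p) * (int (Suc k) * Q)"
      unfolding dv by (simp add: Suc_diff_le algebra_simps)
    finally have P': "[(int p * int n - int (Suc k)) * P
        = (- 1) ^ (Suc k - Suc k div p) * (int (Suc k) * Q)] (mod int p ^ a)" .
    have "coprime (int (Suc k)) (int p)"
      using False p by (metis coprime_commute coprime_int_iff prime_imp_coprime)
    then have Q': "coprime (int (Suc k) * Q) (int p)"
      using Q by simp
    have "int ((p * n - 1) choose Suc k) * (int (Suc k) * Q)
        = int ((n - 1) choose (Suc k div p)) * ((int p * int n - int (Suc k)) * P)"
      unfolding dv using stepk eq by algebra
    then show ?thesis
      using P' Q' by blast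
  next
    case True
    then obtain j where j: "Suc k = p * Suc j"
      by (metis dvd_def gr0_implies_Suc mult_0_right nat.distinct(1) neq0_conv)
    have dv: "Suc k div p = Suc j"
      using j p0 by simp
    have dvk: "k div p = j"
    proof -
      have "Suc (k div p) = Suc j"
        using True dv by (simp add: div_Suc dvd_eq_mod_eq_0)
      then show ?thesis by simp
    qed
    have sg: "Suc k - Suc k div p = k - k div p"
      unfolding dv dvk by simp
    have "int p * (int (Suc j) * int ((p * n - 1) choose Suc k))
        = int p * ((int n - int (Suc j)) * int ((p * n - 1) choose k))"
      using stepk unfolding j of_nat_mult by (simp only: algebra_simps)
    then have big: "int (Suc j) * int ((p * n - 1) choose Suc k)
        = (int n - int (Suc j)) * int ((p * n - 1) choose k)"
      using p0 by simp
    have small: "int (Suc j) * int ((n - 1) choose Suc j)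
        = (int n - int (Suc j)) * int ((n - 1) choose j)"
      using step[OF n] .
    have "int (Suc j) * (int ((p * n - 1) choose Suc k) * Q)
        = int (Suc j) * (int ((n - 1) choose Suc j) * P)"
      using big small eq unfolding dvk by algebra
    then have "int ((p * n - 1) choose Suc k) * Q = int ((n - 1) choose (Suc k div p)) * P"
      unfolding dv by simp
    then show ?thesis
      using P Q unfolding sg by blast
  qed
qed

lemma binomial_pred_cong:
  fixes p n a k :: nat
  assumes "prime p" and "n > 0" and "p ^ a dvd p * n"
  shows "[int ((p * n - 1) choose k)
    = (- 1) ^ (k - k div p) * int ((n - 1) choose (k div p))] (mod int p ^ a)"
proof -
  obtain P Q where Q: "coprime Q (int p)"
    and P: "[P = (- 1) ^ (k - k div p) * Q] (mod int p ^ a)"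
    and eq: "int ((p * n - 1) choose k) * Q = int ((n - 1) choose (k div p)) * P"
    using binomial_pred_factor[OF assms] by blast
  have "[int ((p * n - 1) choose k) * Q
      = ((- 1) ^ (k - k div p) * int ((n - 1) choose (k div p))) * Q] (mod int p ^ a)"
    unfolding eq using cong_scalar_left[OF P, of "int ((n - 1) choose (k div p))"]
    by (simp add: ac_simps)
  then show ?thesis
    using Q by (simp add: cong_mult_rcancel)
qed

text \<open>
  Pascal's rule writes \<open>pn choose k\<close> as the sum of two coefficients covered by
  \<open>binomial_pred_cong\<close>. Unless \<open>p\<close> divides \<open>k\<close>, the quotients \<open>(k - 1) div p\<close> and \<open>k div p\<close> agree and
  the two terms cancel. If \<open>k = pj\<close>, the signs agree and Pascal's rule recombines the terms to
  \<open>n choose j\<close>. Using \<open>pn - 1 choose k\<close> at \<open>k = pn\<close> as well means that the top coefficient is no exception.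
\<close>

lemma binomial_cong:
  fixes p n a j r :: nat
  assumes p: "prime p" and n: "n > 0" and a: "p ^ a dvd p * n" and r: "r < p"
  shows "[int ((p * n) choose (p * j + r))
    = (if r = 0 then (- 1) ^ ((p - 1) * j) * int (n choose j) else 0)] (mod int p ^ a)"
proof (cases "p * j + r")
  case 0
  then show ?thesis
    using r by auto
next
  case (Suc k)
  have p0: "p > 0"
    using r by simp
  have pascal: "m choose Suc k = (m - 1 choose k) + (m - 1 choose Suc k)" if "m > 0" for m k :: nat
    using that by (cases m) auto
  have dvS: "Suc k div p = j"
    using Suc r by (metis add.right_neutral div_less div_mult_self4 less_nat_zero_code)
  have "[int ((p * n - 1) choose k) + int ((p * n - 1) choose Suc k)
      = (- 1) ^ (k - k div p) * int ((n - 1) choose (k div p))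
        + (- 1) ^ (Suc k - Suc k div p) * int ((n - 1) choose (Suc k div p))] (mod int p ^ a)"
    by (intro cong_add binomial_pred_cong assms)
  then have main: "[int ((p * n) choose (p * j + r))
      = (- 1) ^ (k - k div p) * int ((n - 1) choose (k div p))
        + (- 1) ^ (Suc k - j) * int ((n - 1) choose j)] (mod int p ^ a)"
    using pascal[of "p * n" k] p0 n unfolding Suc dvS by simp
  show ?thesis
  proof (cases "r = 0")
    case False
    then have "\<not> p dvd Suc k"
      using Suc r by (metis dvd_add_right_iff dvd_triv_left nat_dvd_not_less neq0_conv)
    then have "k div p = j"
      using dvS by (simp add: div_Suc dvd_eq_mod_eq_0)
    moreover from this have "Suc k - j = Suc (k - j)"
      using div_le_dividend[of k p] by (simp add: Suc_diff_le)
    ultimately show ?thesis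
      using main False by simp
  next
    case True
    then obtain i where i: "j = Suc i"
      using Suc by (cases j) auto
    have "Suc (k div p) = j"
      using dvS Suc True by (metis add.right_neutral div_Suc dvd_triv_left mod_eq_0_iff_dvd)
    then have dvk: "k div p = i"
      using i by simp
    have e1: "Suc k - j = (p - 1) * j"
      using Suc True by (simp add: diff_mult_distrib)
    have e2: "k - k div p = (p - 1) * j"
      using e1 unfolding dvk i by simp
    have "int (n choose j) = int ((n - 1) choose i) + int ((n - 1) choose j)"
      using pascal[OF n] i by simp
    then show ?thesis
      using main True unfolding e1 e2 unfolding dvk by (simp only: distrib_left simp_thms if_True add_0_right)
  qed
qed

text \<open>
  With \<open>x = y + mt\<close>, the difference of the cubes is \<open>3mty\<^sup>2 + 3m\<^sup>2t\<^sup>2y + m\<^sup>3t\<^sup>3\<close>, where each term has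
  besides \<open>m\<close> either a factor 3 or another factor \<open>m\<close>. The lemma will serve with \<open>d = gcd 3 p\<close>.
\<close>

lemma cong_cube:
  fixes x y d m :: int
  assumes xy: "[x = y] (mod m)" and d3: "d dvd 3" and dm: "d dvd m"
  shows "[x ^ 3 = y ^ 3] (mod d * m)"
proof -
  obtain t where t: "x = y + m * t"
    using xy by (metis cong_iff_lin cong_sym)
  obtain u v where u: "3 = d * u" and v: "m = d * v"
    using d3 dm by (metis dvd_def)
  have "x ^ 3 - y ^ 3 = 3 * (m * t * y ^ 2 + m ^ 2 * t ^ 2 * y) + m * (m ^ 2 * t ^ 3)"
    unfolding t by algebra
  also have "\<dots> = (d * u) * (m * t * y ^ 2 + m ^ 2 * t ^ 2 * y) + (d * v) * (m ^ 2 * t ^ 3)"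
    using u v by simp
  also have "\<dots> = d * m * (u * (t * y ^ 2 + m * t ^ 2 * y) + v * m * t ^ 3)"
    by algebra
  finally show ?thesis
    by (simp add: cong_iff_dvd_diff)
qed

lemma sign_cube: "((- 1) ^ k * x) ^ 3 = (- 1) ^ k * (x :: int) ^ 3"
  by (cases "even k") simp_all

section \<open>Franel numbers modulo prime powers\<close>

lemma sum_by_residues:
  fixes g :: "nat \<Rightarrow> int"
  shows "(\<Sum>k<p * n. g k) = (\<Sum>j<n. \<Sum>r<p. g (p * j + r))"
proof -
  have "(\<Sum>k<p * n. g k) = (\<Sum>j<n. sum g {j * p..<j * p + p})"
    by (simp add: sum.nat_group mult.commute)
  moreover have "sum g {j * p..<j * p + p} = (\<Sum>r<p. g (p * j + r))" for j
    using sum.shift_bounds_nat_ivl[of g 0 "j * p" p]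
    by (simp add: lessThan_atLeast0 add.commute mult.commute)
  ultimately show ?thesis
    by simp
qed

text \<open>
  The right-hand side is \<open>f\<^sub>n\<close> for odd \<open>p\<close>; for \<open>p = 2\<close> it is the alternating sum of the cubes.
\<close>

lemma franel_mult_cong:
  fixes p n a :: nat
  assumes p: "prime p" and n: "n > 0" and a: "p ^ a dvd p * n" and "a > 0"
  shows "[int (franel (p * n)) = (\<Sum>j\<le>n. (- 1) ^ ((p - 1) * j) * int (n choose j) ^ 3)]
    (mod gcd 3 (int p) * int p ^ a)"
proof -
  have p0: "p > 0"
    using p prime_gt_0_nat by blast
  have d: "gcd 3 (int p) dvd int p ^ a"
    using \<open>a > 0\<close> by (meson dvd_power dvd_trans gcd_dvd2)
  \<comment> \<open>The range is padded by \<open>p - 1\<close> zero terms to a whole number of blocks of length \<open>p\<close>.\<close>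
  have "int (franel (p * n)) = (\<Sum>k<p * Suc n. int ((p * n) choose k) ^ 3)"
  proof -
    have "p * Suc n = Suc (p * n + (p - 1))"
      using p0 by simp
    then show ?thesis
      using franel_sum[of "p * n" "p * n + (p - 1)"] by (simp only: lessThan_Suc_atMost)
  qed
  also have "\<dots> = (\<Sum>j<Suc n. \<Sum>r<p. int ((p * n) choose (p * j + r)) ^ 3)"
    by (rule sum_by_residues)
  also have "[\<dots> = (\<Sum>j<Suc n. \<Sum>r<p.
      (if r = 0 then (- 1) ^ ((p - 1) * j) * int (n choose j) else 0) ^ 3)]
      (mod gcd 3 (int p) * int p ^ a)"
    by (intro cong_sum cong_cube binomial_cong p n a d gcd_dvd1) auto
  also have "(\<Sum>j<Suc n. \<Sum>r<p.
      (if r = 0 then (- 1) ^ ((p - 1) * j) * int (n choose j) else 0) ^ 3)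
      = (\<Sum>j<Suc n. ((- 1) ^ ((p - 1) * j) * int (n choose j)) ^ 3)"
  proof (rule sum.cong[OF refl])
    fix j
    have "(\<Sum>r<p. (if r = 0 then c else 0) ^ 3) = c ^ 3" for c :: int
    proof -
      have "(\<Sum>r<p. (if r = 0 then c else 0) ^ 3) = (\<Sum>r<p. if r = 0 then c ^ 3 else 0)"
        by (intro sum.cong) auto
      then show ?thesis
        using p0 by simp
    qed
    then show "(\<Sum>r<p. (if r = 0 then (- 1) ^ ((p - 1) * j) * int (n choose j) else 0) ^ 3)
        = ((- 1) ^ ((p - 1) * j) * int (n choose j)) ^ 3" .
  qed
  also have "\<dots> = (\<Sum>j\<le>n. (- 1) ^ ((p - 1) * j) * int (n choose j) ^ 3)"
    unfolding lessThan_Suc_atMost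
    by (simp only: sign_cube)
  finally show ?thesis .
qed

text \<open>
  The \<open>p\<close> indices \<open>k\<close> with \<open>k div p = j\<close> contribute \<open>(n - 1 choose j)\<^sup>3\<close> with alternating signs,
  starting with a plus sign if \<open>p\<close> is odd. Their number \<open>p\<close> decides whether one copy remains or none.
\<close>

lemma franel_pred_cong:
  fixes p n a :: nat
  assumes p: "prime p" and n: "n > 0" and a: "p ^ a dvd p * n" and "a > 0"
  shows "[int (franel (p * n - 1)) = (if p = 2 then 0 else int (franel (n - 1)))]
    (mod gcd 3 (int p) * int p ^ a)"
proof -
  have p0: "p > 0"
    using p prime_gt_0_nat by blast
  have d: "gcd 3 (int p) dvd int p ^ a"
    using \<open>a > 0\<close> by (meson dvd_power dvd_trans gcd_dvd2)
  have alt: "(\<Sum>r<p. (- 1) ^ (p * j + r - j)) = ((if p = 2 then 0 else 1) :: int)" for j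
  proof (cases "p = 2")
    case True
    then show ?thesis
      by (simp add: numeral_2_eq_2)
  next
    case False
    then obtain q where q: "p = Suc (2 * q)"
      using p by (metis oddE prime_odd_nat prime_ge_2_nat Suc_eq_plus1 order_le_less)
    have "(\<Sum>r<Suc (2 * m). (- 1) ^ r) = (1 :: int)" for m
      by (induction m) auto
    moreover have "(- 1 :: int) ^ (p * j + r - j) = (- 1) ^ r" for r
      unfolding q by (simp add: power_add minus_one_power_iff)
    ultimately show ?thesis
      using False q by simp
  qed
  have "p * n = Suc (p * n - 1)"
    using p0 n by simp
  then have "int (franel (p * n - 1)) = (\<Sum>k<p * n. int ((p * n - 1) choose k) ^ 3)"
    using franel_sum[of "p * n - 1" "p * n - 1"] by (metis lessThan_Suc_atMost order_refl)
  also have "\<dots> = (\<Sum>j<n. \<Sum>r<p. int ((p * n - 1) choose (p * j + r)) ^ 3)"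
    by (rule sum_by_residues)
  finally have lhs: "int (franel (p * n - 1))
      = (\<Sum>j<n. \<Sum>r<p. int ((p * n - 1) choose (p * j + r)) ^ 3)" .
  have main: "[(\<Sum>j<n. \<Sum>r<p. int ((p * n - 1) choose (p * j + r)) ^ 3) = (\<Sum>j<n. \<Sum>r<p.
      ((- 1) ^ (p * j + r - (p * j + r) div p) * int ((n - 1) choose ((p * j + r) div p))) ^ 3)]
      (mod gcd 3 (int p) * int p ^ a)"
    by (intro cong_sum cong_cube binomial_pred_cong p n a d gcd_dvd1)
  have "(\<Sum>j<n. \<Sum>r<p.
      ((- 1) ^ (p * j + r - (p * j + r) div p) * int ((n - 1) choose ((p * j + r) div p))) ^ 3)
      = (\<Sum>j<n. \<Sum>r<p. (- 1) ^ (p * j + r - j) * int ((n - 1) choose j) ^ 3)"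
  proof (intro sum.cong refl)
    fix j r assume "r \<in> {..<p}"
    then have "(p * j + r) div p = j"
      by simp
    then show "((- 1) ^ (p * j + r - (p * j + r) div p)
          * int ((n - 1) choose ((p * j + r) div p))) ^ 3
        = (- 1) ^ (p * j + r - j) * int ((n - 1) choose j) ^ 3"
      by (simp only: sign_cube)
  qed
  also have "\<dots> = (\<Sum>j<n. (if p = 2 then 0 else 1) * int ((n - 1) choose j) ^ 3)"
    unfolding sum_distrib_right[symmetric] alt ..
  also have "\<dots> = (if p = 2 then 0 else int (franel (n - 1)))"
  proof -
    have "n = Suc (n - 1)"
      using n by simp
    then have "int (franel (n - 1)) = (\<Sum>j<n. int ((n - 1) choose j) ^ 3)"
      using franel_sum[of "n - 1" "n - 1"] by (metis lessThan_Suc_atMost order_refl)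
    then show ?thesis
      by simp
  qed
  finally show ?thesis
    using main unfolding lhs by (simp only:)
qed

text \<open>
  For \<open>n > 0\<close>, this is \<open>3 S(n) / n\<^sup>2\<close>; it satisfies the Gauss congruences.
\<close>

definition franel_gauss :: "nat \<Rightarrow> int" where
  "franel_gauss n = alt_franel n + 8 * alt_franel (n - 1)"

text \<open>
  For \<open>p = 2\<close> the sum in \<open>franel_mult_cong\<close> carries the sign \<open>(-1)\<^sup>j\<close> and \<open>a\<^sub>n\<close> the sign \<open>(-1)\<^sup>n\<close>.
  They differ only when \<open>j\<close> and \<open>n\<close> have different parity, by twice the cube of \<open>n choose j\<close>. This
  is enough: for odd \<open>n\<close> the modulus is 2, and for even \<open>n\<close> and odd \<open>j\<close> the identity
  \<open>j (n choose j) = n (n - 1 choose j - 1)\<close> shows that \<open>2\<^sup>e\<close> divides \<open>n choose j\<close>.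
\<close>

lemma franel_gauss_cong_2:
  assumes n: "n > 0" and e: "2 ^ e dvd n"
  shows "[franel_gauss (2 * n) = franel_gauss n] (mod 2 ^ Suc e)"
proof -
  have pr: "prime (2 :: nat)"
    by (rule two_is_prime_nat)
  have a: "2 ^ Suc e dvd 2 * n"
    using e by simp
  have f: "[int (franel (2 * n)) = (\<Sum>j\<le>n. (- 1) ^ j * int (n choose j) ^ 3)] (mod 2 ^ Suc e)"
    using franel_mult_cong[OF pr n a] by simp
  have f': "[int (franel (2 * n - 1)) = 0] (mod 2 ^ Suc e)"
    using franel_pred_cong[OF pr n a] by simp
  \<comment> \<open>For even \<open>n\<close> this is \<open>f'\<close> with \<open>n div 2\<close> in place of \<open>n\<close>; it loses a factor 2, which the coefficient 8 restores.\<close>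
  have g: "2 ^ e dvd int (franel (n - 1))"
  proof (cases "e = 0")
    case False
    then obtain m where m: "n = 2 * m"
      using e by (metis dvdE dvd_trans dvd_power neq0_conv)
    then show ?thesis
      using franel_pred_cong[of 2 m e, OF pr] n e False by (simp add: cong_0_iff)
  qed simp
  have parity: "[(- 1) ^ j * int (n choose j) ^ 3 = (- 1) ^ n * int (n choose j) ^ 3]
      (mod 2 ^ Suc e)" for j
  proof (cases "even j = even n")
    case True
    then show ?thesis
      by (simp add: minus_one_power_iff)
  next
    case False
    have "2 ^ e dvd n choose j"
    proof (cases "even n")
      case True
      with False have "odd j" by simp
      then obtain i where i: "j = Suc i"
        by (cases j) auto
      have "j * (n choose j) = n * ((n - 1) choose i)"
        unfolding i by (rule binomial_absorption)
      then have "2 ^ e dvd j * (n choose j)"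
        using e by simp
      then show ?thesis
        using \<open>odd j\<close> by (simp add: coprime_dvd_mult_right_iff)
    next
      case odd: False
      then have "e = 0"
        using e by (metis dvd_power dvd_trans neq0_conv)
      then show ?thesis by simp
    qed
    then have "2 ^ e dvd int (n choose j)"
      by (metis of_nat_dvd_iff of_nat_numeral of_nat_power)
    then have "2 ^ e dvd int (n choose j) ^ 3"
      by (simp add: dvd_power_same dvd_trans[OF _ dvd_power])
    then have "2 ^ Suc e dvd 2 * int (n choose j) ^ 3"
      by simp
    then show ?thesis
      using False by (cases "even n") (auto simp: minus_one_power_iff cong_iff_dvd_diff)
  qed
  have "[(\<Sum>j\<le>n. (- 1) ^ j * int (n choose j) ^ 3) = (\<Sum>j\<le>n. (- 1) ^ n * int (n choose j) ^ 3)]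
      (mod 2 ^ Suc e)"
    by (intro cong_sum parity)
  also have "(\<Sum>j\<le>n. (- 1) ^ n * int (n choose j) ^ 3) = alt_franel n"
    using franel_sum[of n n] by (simp add: alt_franel_def sum_distrib_left)
  finally have "[int (franel (2 * n)) = alt_franel n] (mod 2 ^ Suc e)"
    by (rule cong_trans[OF f])
  then have "[alt_franel (2 * n) = alt_franel n] (mod 2 ^ Suc e)"
    by (simp add: alt_franel_def)
  moreover have "[8 * alt_franel (2 * n - 1) = 8 * alt_franel (n - 1)] (mod 2 ^ Suc e)"
  proof -
    have "2 ^ Suc e dvd 8 * alt_franel (2 * n - 1)"
      using f' by (simp add: alt_franel_def cong_0_iff)
    moreover have "2 ^ Suc e dvd 8 * alt_franel (n - 1)"
      using mult_dvd_mono[OF _ g, of 2 8] by (simp add: alt_franel_def minus_one_power_iff)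
    ultimately show ?thesis
      by (simp add: cong_iff_dvd_diff)
  qed
  ultimately show ?thesis
    unfolding franel_gauss_def by (rule cong_add)
qed

lemma franel_gauss_cong:
  fixes p n e :: nat
  assumes p: "prime p" and n: "n > 0" and e: "p ^ e dvd n"
  shows "[franel_gauss (p * n) = franel_gauss n] (mod gcd 3 (int p) * int p ^ Suc e)"
proof (cases "p = 2")
  case True
  then show ?thesis
    using franel_gauss_cong_2[of n e] n e by simp
next
  case False
  have "odd p"
    using p False by (metis prime_odd_nat prime_ge_2_nat order_le_less)
  have a: "p ^ Suc e dvd p * n"
    using e by simp
  have "p * n > 0"
    using p n prime_gt_0_nat by simp
  have s: "(- 1 :: int) ^ (p * n) = (- 1) ^ n" "(- 1 :: int) ^ (p * n - 1) = (- 1) ^ (n - 1)"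
    using \<open>odd p\<close> n \<open>p * n > 0\<close> by (auto simp: minus_one_power_iff)
  have "[int (franel (p * n)) = int (franel n)] (mod gcd 3 (int p) * int p ^ Suc e)"
    using franel_mult_cong[OF p n a] franel_sum[of n n] \<open>odd p\<close> by (simp add: minus_one_power_iff)
  moreover have "[int (franel (p * n - 1)) = int (franel (n - 1))]
      (mod gcd 3 (int p) * int p ^ Suc e)"
    using franel_pred_cong[OF p n a] False by simp
  ultimately show ?thesis
    unfolding franel_gauss_def alt_franel_def s by (intro cong_add cong_mult cong_refl)
qed

section \<open>The congruence for the weighted sums\<close>

lemma of_int_divide_in_Z_loc:
  assumes "\<not> int p dvd d"
  shows "of_int c / of_int d \<in> Z_loc p"
proof -
  obtain a b where ab: "quotient_of (of_int c / of_int d) = (a, b)"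
    by (cases "quotient_of (of_int c / of_int d)")
  have d0: "d \<noteq> 0"
    using assms by auto
  have b0: "b > 0" and cop: "coprime a b"
    using ab quotient_of_denom_pos quotient_of_coprime by blast+
  have "of_int c / of_int d = (of_int a / of_int b :: rat)"
    using quotient_of_div[OF ab] .
  then have "(of_int (c * b) :: rat) = of_int (a * d)"
    using d0 b0 by (simp add: field_simps)
  then have "c * b = a * d"
    by (simp only: of_int_eq_iff)
  then have "b dvd a * d"
    by (metis dvd_triv_right)
  then have "b dvd d"
    using cop by (simp add: coprime_commute coprime_dvd_mult_right_iff)
  then show ?thesis
    using assms ab by (auto simp: Z_loc_def dest: dvd_trans)
qed

definition franel_weighted :: "nat \<Rightarrow> int" where
  "franel_weighted n = (\<Sum>k=0..n - 1. (3 * int k + 2) * alt_franel k)"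

lemma franel_weighted_eq:
  assumes "n > 0"
  shows "3 * franel_weighted n = int n ^ 2 * franel_gauss n"
  using franel_weighted_sum[of "n - 1"] assms
  by (simp add: franel_weighted_def franel_gauss_def atMost_atLeast0 of_nat_diff)

lemma franel_weighted_dvd:
  fixes p n e :: nat
  assumes p: "prime p" and n: "n > 0" and e: "p ^ e dvd n"
  shows "int p ^ (3 * e + 3) dvd franel_weighted (p * n) - int p ^ 2 * franel_weighted n"
proof -
  define D where "D = franel_weighted (p * n) - int p ^ 2 * franel_weighted n"
  have pn: "p * n > 0"
    using p n prime_gt_0_nat by simp
  have D: "3 * D = int p ^ 2 * int n ^ 2 * (franel_gauss (p * n) - franel_gauss n)"
    using franel_weighted_eq[OF n] franel_weighted_eq[OF pn]
    unfolding D_def of_nat_mult by algebra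
  have "int p ^ e dvd int n"
    using e by (metis of_nat_dvd_iff of_nat_power)
  then have "int p ^ 2 * (int p ^ e) ^ 2 * (gcd 3 (int p) * int p ^ Suc e) dvd 3 * D"
    unfolding D using franel_gauss_cong[OF p n e]
    by (intro mult_dvd_mono dvd_power_same) (auto simp: cong_iff_dvd_diff)
  also have "int p ^ 2 * (int p ^ e) ^ 2 * (gcd 3 (int p) * int p ^ Suc e)
      = gcd 3 (int p) * int p ^ (3 * e + 3)"
    by (simp add: power_add power_mult power2_eq_square power3_eq_cube power_mult_distrib mult_ac)
  finally have dv: "gcd 3 (int p) * int p ^ (3 * e + 3) dvd 3 * D" .
  have "int p ^ (3 * e + 3) dvd D"
  proof (cases "p = 3")
    case True
    then show ?thesis
      using dv by simp
  next
    case False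
    have "coprime p 3"
      using p False by (simp add: primes_coprime)
    then have "coprime (int p ^ (3 * e + 3)) 3"
      by (metis coprime_int_iff coprime_power_left_iff of_nat_numeral)
    then show ?thesis
      using dv by (metis coprime_dvd_mult_right_iff dvd_mult_right)
  qed
  then show ?thesis
    unfolding D_def .
qed

theorem theorem2:
  fixes p n :: nat
  assumes "prime p" and "n > 0"
  shows "rat_cong_0
    (1 / of_nat n ^ 3 *
      ((\<Sum>k=0..p * n - 1. (3 * of_nat k + 2) * (- 1) ^ k * of_nat (franel k))
       - of_nat p ^ 2 * (\<Sum>k=0..n - 1. (3 * of_nat k + 2) * (- 1) ^ k * of_nat (franel k))))
    p 3"
proof -
  obtain e m where m: "\<not> p dvd m" and nm: "n = p ^ e * m"
    using multiplicity_decompose'[of n p] assms by (metis neq0_conv not_prime_unit)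
  then have "p ^ e dvd n"
    by simp
  then obtain c where c: "franel_weighted (p * n) - int p ^ 2 * franel_weighted n
      = int p ^ (3 * e + 3) * c"
    using franel_weighted_dvd[OF assms] by (auto elim: dvdE)
  have W: "(\<Sum>k=0..N - 1. (3 * of_nat k + 2) * (- 1) ^ k * of_nat (franel k))
      = (of_int (franel_weighted N) :: rat)" for N
    by (simp add: franel_weighted_def alt_franel_def mult.assoc)
  have "p > 0" "m > 0"
    using assms nm prime_gt_0_nat by auto
  have "(of_int (franel_weighted (p * n)) - of_nat p ^ 2 * of_int (franel_weighted n) :: rat)
      = of_int (int p ^ (3 * e + 3) * c)"
    unfolding c[symmetric] by simp
  then have eq: "1 / of_nat n ^ 3 * (of_int (franel_weighted (p * n))
        - of_nat p ^ 2 * of_int (franel_weighted n))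
      = of_nat p ^ 3 * (of_int c / of_int (int m ^ 3) :: rat)"
    using \<open>p > 0\<close> \<open>m > 0\<close> unfolding nm
    by (simp add: field_simps power_add power_mult)
  have "\<not> p dvd m ^ 3"
    using m assms(1) prime_dvd_power by blast
  then have "\<not> int p dvd int m ^ 3"
    by (metis of_nat_dvd_iff of_nat_power)
  then show ?thesis
    unfolding rat_cong_0_def W eq by (intro imageI of_int_divide_in_Z_loc)
qed

end
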